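(* Let $\mathbb{F}$ be any field and $G$ any torsion-free group. Let $\alpha,\beta\in\mathbb{F}[G]$ be non-zero elements with $|supp(\alpha)|=3$ and $\alpha\beta=0$. Then the zero-divisor graph $Z(\alpha,\beta)$ has no subgraph isomorphic to either of the following two graphs: (i) two triangles with exactly one edge in common, i.e. the simple graph on four distinct vertices $u,v,w,z$ with edge set $\{uv,vw,wu,uz,zw\}$; (ii) the complete bipartite graph $K_{2,3}$.
   Context: For $\alpha=\sum_{x\in G}a_xx\in\mathbb{F}[G]$, $supp(\alpha)=\{x\in G: a_x\neq 0\}$. For non-zero $\alpha,\beta\in\mathbb{F}[G]$ with $\alpha\beta=0$, the zero-divisor graph $Z(\alpha,\beta)$ is the undirected loopless graph (possibly with multiple edges a priori) with vertex set $supp(\beta)$ and with edge set $$\left\{\{(h,h',g,g'),(h',h,g',g)\} : h,h'\in supp(\alpha),\ g,g'\in supp(\beta),\ g\neq g',\ hg=h'g'\right\},$$ where the edge $\{(h,h',g,g'),(h',h,g',g)\}$ joins $g$ and $g'$. If $|supp(\alpha)|=3$, it is called a zero-divisor graph of length $3$ over $\mathbb{F}$ and on $G$. A subgraph means a (not necessarily induced) subgraph. *)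

theory Defs
  imports Complex_Main "HOL-Library.Poly_Mapping"
begin

text \<open>
  The class \<^class>\<open>group_add\<close> consists of arbitrary, not necessarily commutative groups; only the
  notation is additive.  For \<open>'g :: group_add\<close> and \<open>'f :: field\<close>, the type \<open>'g \<Rightarrow>\<^sub>0 'f\<close> of finitely
  supported functions with the convolution product of \<^theory>\<open>HOL-Library.Poly_Mapping\<close> is the
  group algebra over \<open>'f\<close> of \<open>'g\<close>, and \<^const>\<open>Poly_Mapping.keys\<close> is the support.
\<close>

definition torsion_free :: "'g::group_add itself \<Rightarrow> bool" where
  "torsion_free _ \<longleftrightarrow> (\<forall>(x::'g) (n::nat). n > 0 \<longrightarrow> ((+) x ^^ n) 0 = 0 \<longrightarrow> x = 0)"

text \<open>
  Undirected graphs, possibly with multiple edges: \<open>mends e\<close> is the set of endpoints of the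
  edge \<open>e\<close>.  Its value outside \<open>medges\<close> is irrelevant.
\<close>

record ('v, 'e) multigraph =
  mverts :: "'v set"
  medges :: "'e set"
  mends :: "'e \<Rightarrow> 'v set"

definition loopless_multigraph :: "('v, 'e) multigraph \<Rightarrow> bool" where
  "loopless_multigraph X \<longleftrightarrow>
     (\<forall>e\<in>medges X. mends X e \<subseteq> mverts X \<and> card (mends X e) = 2)"

text \<open>Subgraphs need not be induced.\<close>

definition msubgraph :: "('v, 'e) multigraph \<Rightarrow> ('v, 'e) multigraph \<Rightarrow> bool" where
  "msubgraph H X \<longleftrightarrow> loopless_multigraph H \<and>
     mverts H \<subseteq> mverts X \<and> medges H \<subseteq> medges X \<and>
     (\<forall>e\<in>medges H. mends H e = mends X e)"

definition misomorphic :: "('v, 'e) multigraph \<Rightarrow> ('w, 'd) multigraph \<Rightarrow> bool" where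
  "misomorphic X Y \<longleftrightarrow>
     (\<exists>\<phi> \<psi>. bij_betw \<phi> (mverts X) (mverts Y) \<and> bij_betw \<psi> (medges X) (medges Y) \<and>
        (\<forall>e\<in>medges X. mends Y (\<psi> e) = \<phi> ` mends X e))"

definition has_subgraph_iso :: "('v, 'e) multigraph \<Rightarrow> ('w, 'd) multigraph \<Rightarrow> bool" where
  "has_subgraph_iso X Y \<longleftrightarrow> (\<exists>H. msubgraph H X \<and> misomorphic H Y)"

text \<open>A simple graph is a multigraph whose edges are two-element sets of vertices.\<close>

definition simple_graph :: "'v set \<Rightarrow> 'v set set \<Rightarrow> ('v, 'v set) multigraph" where
  "simple_graph V E = \<lparr>mverts = V, medges = E, mends = (\<lambda>e. e)\<rparr>"

text \<open>The vertices \<open>u, v, w, z\<close> are \<open>0, 1, 2, 3\<close>; the common edge of the two triangles is \<open>uw\<close>.\<close>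

definition two_triangles :: "(nat, nat set) multigraph" where
  "two_triangles = simple_graph {0, 1, 2, 3} {{0, 1}, {1, 2}, {2, 0}, {0, 3}, {3, 2}}"

definition complete_bipartite :: "nat \<Rightarrow> nat \<Rightarrow> (nat + nat, (nat + nat) set) multigraph" where
  "complete_bipartite m n =
     simple_graph (Inl ` {..<m} \<union> Inr ` {..<n}) {{Inl i, Inr j} | i j. i < m \<and> j < n}"

text \<open>
  An edge is the unordered pair of the quadruples \<open>(h, h', g, g')\<close> and \<open>(h', h, g', g)\<close>, so the
  third components of its two members are its endpoints \<open>g\<close> and \<open>g'\<close>.
\<close>

definition zero_divisor_graph ::
  "('g::group_add \<Rightarrow>\<^sub>0 'f::field) \<Rightarrow> ('g \<Rightarrow>\<^sub>0 'f) \<Rightarrow> ('g, ('g \<times> 'g \<times> 'g \<times> 'g) set) multigraph"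
where
  "zero_divisor_graph \<alpha> \<beta> =
     \<lparr>mverts = Poly_Mapping.keys \<beta>,
      medges = {{(h, h', g, g'), (h', h, g', g)} | h h' g g'.
                  h \<in> Poly_Mapping.keys \<alpha> \<and> h' \<in> Poly_Mapping.keys \<alpha> \<and>
                  g \<in> Poly_Mapping.keys \<beta> \<and> g' \<in> Poly_Mapping.keys \<beta> \<and>
                  g \<noteq> g' \<and> h + g = h' + g'},
      mends = (\<lambda>e. (\<lambda>(h, h', g, g'). g) ` e)\<rparr>"

lemma loopless_zero_divisor_graph: "loopless_multigraph (zero_divisor_graph \<alpha> \<beta>)"
  by (auto simp: loopless_multigraph_def zero_divisor_graph_def)

lemma loopless_two_triangles: "loopless_multigraph two_triangles"
  by (auto simp: loopless_multigraph_def two_triangles_def simple_graph_def)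

lemma loopless_complete_bipartite: "loopless_multigraph (complete_bipartite m n)"
  by (auto simp: loopless_multigraph_def complete_bipartite_def simple_graph_def)

end

theory Submission
  imports Defs
begin

text \<open>
  Cancellation in \<open>\<alpha>\<beta> = 0\<close> forces, for each \<open>h \<in> supp \<alpha>\<close>, a nonempty product of elements
  \<open>h'\<^sup>-\<^sup>1h\<close> with \<open>h' \<in> supp \<alpha> \ {h}\<close> to be trivial.  Writing \<open>supp \<alpha> = {h, hx, hy}\<close>, this is
  impossible in a torsion-free group if \<open>x\<close> and \<open>y\<close> commute or satisfy a Baumslag-Solitar relation
  \<open>y x y\<^sup>-\<^sup>1 = x\<^sup>n\<close>.  Every triangle that does not come from a single coefficient of \<open>\<alpha>\<beta>\<close> yields such a
  relation (or torsion), and two such degenerate triangles cannot share exactly one edge.  The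
  4-cycles leave, up to symmetry, only the relations \<open>y\<^sup>3 = x\<^sup>2\<close> and \<open>y\<^sup>2 = x y x\<close>; the three 4-cycles of
  a \<open>K\<^sub>2\<^sub>,\<^sub>3\<close> together then satisfy the relations of \<open>SL(2,3)\<close>, so \<open>x\<close> has finite order.
\<close>

section \<open>Integer multiples in a non-commutative group\<close>

text \<open>Both branches are iterates of the kind used in \<open>torsion_free\<close>. Negative
  multiples are needed because Baumslag-Solitar exponents and cone coordinates take both
  signs.\<close>

definition int_mul :: "int \<Rightarrow> 'g::group_add \<Rightarrow> 'g" where
  "int_mul k x = (if k \<ge> 0 then ((+) x ^^ nat k) 0 else ((+) (- x) ^^ nat (- k)) 0)"

lemma int_mul_0 [simp]: "int_mul 0 x = 0"
  and int_mul_1 [simp]: "int_mul 1 x = x"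
  by (auto simp: int_mul_def)

lemma int_mul_add_one: "int_mul (k + 1) x = x + int_mul k x"
proof (cases "k \<ge> 0")
  case True
  then have "nat (k + 1) = Suc (nat k)" by simp
  with True show ?thesis by (simp add: int_mul_def)
next
  case False
  then have "nat (- k) = Suc (nat (- (k + 1)))" by simp
  with False show ?thesis by (auto simp: int_mul_def)
qed

lemma int_mul_diff_one: "int_mul (k - 1) x = - x + int_mul k x"
  using int_mul_add_one[of "k - 1" x] by simp

lemma int_mul_minus1 [simp]: "int_mul (- 1) x = - x"
  using int_mul_diff_one[of 0 x] by simp

lemma int_mul_add: "int_mul (k + l) x = int_mul k x + int_mul l x"
proof (induction k rule: int_induct[where k = 0])
  case (step1 k)
  have "k + 1 + l = (k + l) + 1" by simp
  with step1 show ?case by (simp only: int_mul_add_one) (simp add: add.assoc)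
next
  case (step2 k)
  have "k - 1 + l = (k + l) - 1" by simp
  with step2 show ?case by (simp only: int_mul_diff_one) (simp add: add.assoc)
qed simp

lemma int_mul_uminus: "int_mul (- k) x = - int_mul k x"
  using int_mul_add[of k "- k" x] by (simp add: minus_unique)

lemma int_mul_2: "int_mul 2 x = x + x"
  using int_mul_add[of 1 1 x] by simp

lemma int_mul_minus2: "int_mul (- 2) x = - x + - x"
  using int_mul_add[of "-1" "-1" x] by simp

lemma int_mul_mult: "int_mul (k * l) x = int_mul k (int_mul l x)"
proof (induction k rule: int_induct[where k = 0])
  case (step1 k)
  have "int_mul ((k + 1) * l) x = int_mul (l + k * l) x" by (simp add: algebra_simps)
  also have "\<dots> = int_mul (k + 1) (int_mul l x)"
    by (simp only: int_mul_add[of l] step1 int_mul_add_one)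
  finally show ?case .
next
  case (step2 k)
  have "int_mul ((k - 1) * l) x = int_mul (- l + k * l) x" by (simp add: algebra_simps)
  also have "\<dots> = int_mul (k - 1) (int_mul l x)"
    by (simp only: int_mul_add[of "- l"] int_mul_uminus step2 int_mul_diff_one)
  finally show ?case .
qed simp

lemma int_mul_zero_right [simp]: "int_mul k 0 = 0"
  using int_mul_mult[of k 0 0] by simp

text \<open>The hypothesis makes \<open>z\<close> the conjugate y x y^-1, and conjugation by
  \<open>y\<close> is a homomorphism.\<close>

lemma int_mul_conj:
  assumes "y + x = z + y"
  shows "y + int_mul k x = int_mul k z + y"
proof (induction k rule: int_induct[where k = 0])
  case (step1 k)
  have "y + int_mul (k + 1) x = z + (y + int_mul k x)"
    using assms by (metis add.assoc int_mul_add_one)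
  then show ?case by (simp add: step1 int_mul_add_one add.assoc)
next
  case (step2 k)
  have "y + - x = - z + y"
    using assms by (metis add.assoc add.right_neutral left_minus add_left_cancel right_minus)
  then have "y + int_mul (k - 1) x = - z + (y + int_mul k x)"
    by (metis add.assoc int_mul_diff_one)
  then show ?case by (simp add: step2 int_mul_diff_one add.assoc)
qed simp

lemma torsion_free_int_mul:
  fixes x :: "'g::group_add"
  assumes "torsion_free TYPE('g)" "int_mul k x = 0" "k \<noteq> 0"
  shows "x = 0"
proof -
  have *: "int_mul \<bar>k\<bar> x = 0"
    using assms(2) int_mul_uminus[of k x] by (simp add: abs_if)
  then have "((+) x ^^ nat \<bar>k\<bar>) 0 = 0" by (simp add: int_mul_def)
  moreover have "nat \<bar>k\<bar> > 0" using assms(3) by simp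
  ultimately show ?thesis using assms(1) unfolding torsion_free_def by blast
qed

section \<open>Subsemigroups and cones that avoid zero\<close>

text \<open>The subsemigroup generated by \<open>S\<close>. The empty sum is left out, so that
  membership of 0 is a genuine relation.\<close>

inductive_set positive_sums :: "'g::group_add set \<Rightarrow> 'g set" for S where
  base: "x \<in> S \<Longrightarrow> x \<in> positive_sums S"
| step: "x \<in> S \<Longrightarrow> y \<in> positive_sums S \<Longrightarrow> x + y \<in> positive_sums S"

lemma positive_sums_add:
  "x \<in> positive_sums S \<Longrightarrow> y \<in> positive_sums S \<Longrightarrow> x + y \<in> positive_sums S"
  by (induction rule: positive_sums.induct) (simp_all add: add.assoc positive_sums.intros)

lemma positive_sums_uminus:
  "x \<in> positive_sums S \<Longrightarrow> - x \<in> positive_sums (uminus ` S)"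
proof (induction rule: positive_sums.induct)
  case (step x y)
  then have "- y + - x \<in> positive_sums (uminus ` S)"
    by (intro positive_sums_add positive_sums.base[of "- x"]) auto
  then show ?case by (simp add: minus_add)
qed (auto intro: positive_sums.base)

lemma positive_sums_subset:
  assumes "S \<subseteq> Q" "\<And>x y. x \<in> Q \<Longrightarrow> y \<in> Q \<Longrightarrow> x + y \<in> Q"
  shows "positive_sums S \<subseteq> Q"
proof
  fix x assume "x \<in> positive_sums S"
  then show "x \<in> Q" by induction (use assms in auto)
qed

text \<open>In a group with \<open>t + a = n a + t\<close> the elements below are those of positive height with
  respect to \<open>t\<close>, together with the positive multiples of \<open>a\<close>.\<close>

definition bs_cone :: "'g::group_add \<Rightarrow> 'g \<Rightarrow> 'g set" where
  "bs_cone a t = {int_mul k a + int_mul m t | k m. m > 0 \<or> m = 0 \<and> k > 0}"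

text \<open>For m >= 0 the relation lets m t move past k a, turning it into k n^m a. Thus heights
  add up, and at height 0 so do the multiples of \<open>a\<close>.\<close>

lemma bs_cone_add:
  assumes "t + a = int_mul n a + t" "x \<in> bs_cone a t" "y \<in> bs_cone a t"
  shows "x + y \<in> bs_cone a t"
proof -
  have shift: "\<exists>l. int_mul m t + int_mul k a = int_mul l a + int_mul m t" if "m \<ge> 0" for m k
    using that
  proof (induction m rule: int_ge_induct)
    case base
    show ?case by (rule exI[of _ k]) simp
  next
    case (step m)
    then obtain l where l: "int_mul m t + int_mul k a = int_mul l a + int_mul m t" by blast
    have "int_mul (m + 1) t + int_mul k a = t + int_mul l a + int_mul m t"
      by (simp add: int_mul_add_one add.assoc l)
    also have "t + int_mul l a = int_mul (l * n) a + t"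
      using int_mul_conj[OF assms(1)] by (simp add: int_mul_mult)
    finally show ?case by (auto simp: int_mul_add_one add.assoc)
  qed
  obtain k m k' m' where x: "x = int_mul k a + int_mul m t" "m > 0 \<or> m = 0 \<and> k > 0"
    and y: "y = int_mul k' a + int_mul m' t" "m' > 0 \<or> m' = 0 \<and> k' > 0"
    using assms unfolding bs_cone_def by blast
  show ?thesis
  proof (cases "m = 0")
    case True
    then have "x + y = int_mul (k + k') a + int_mul m' t"
      by (simp add: x y int_mul_add add.assoc)
    moreover have "m' > 0 \<or> m' = 0 \<and> k + k' > 0" using x y True by auto
    ultimately show ?thesis unfolding bs_cone_def by blast
  next
    case False
    with x have m: "m > 0" by auto
    from shift[of m k'] m obtain l where l: "int_mul m t + int_mul k' a = int_mul l a + int_mul m t"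
      by auto
    have "x + y = int_mul k a + (int_mul m t + int_mul k' a) + int_mul m' t"
      by (simp add: x y add.assoc)
    also have "\<dots> = int_mul (k + l) a + int_mul (m + m') t"
      by (simp add: l int_mul_add add.assoc)
    finally show ?thesis using m y unfolding bs_cone_def
      by (intro CollectI exI[of _ "k + l"] exI[of _ "m + m'"]) auto
  qed
qed

text \<open>If k a + m t = 0, then k a is a multiple of \<open>t\<close> and commutes with it,
  whereas conjugation by \<open>t\<close> multiplies it by n. Hence (n - 1) k a = 0, so k = 0, and m
  t = 0 with m > 0 is torsion.\<close>

lemma zero_notin_bs_cone:
  fixes a t :: "'g::group_add"
  assumes tf: "torsion_free TYPE('g)" and "a \<noteq> 0" "t \<noteq> 0" "n \<noteq> 1"
    and rel: "t + a = int_mul n a + t"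
  shows "0 \<notin> bs_cone a t"
proof
  assume "0 \<in> bs_cone a t"
  then obtain k m where km: "int_mul k a + int_mul m t = 0" "m > 0 \<or> m = 0 \<and> k > 0"
    unfolding bs_cone_def by (smt (verit, best) mem_Collect_eq)
  then have ka: "int_mul k a = int_mul (- m) t"
    by (simp add: int_mul_uminus eq_neg_iff_add_eq_0)
  have "int_mul (n * k) a + t = t + int_mul k a"
    using int_mul_conj[OF rel, of k] by (simp add: int_mul_mult mult.commute)
  also have "\<dots> = int_mul k a + t"
    using int_mul_add[of 1 "- m" t] int_mul_add[of "- m" 1 t] by (simp add: ka add.commute)
  finally have "int_mul (n * k) a = int_mul k a" by simp
  then have "int_mul (n * k - k) a = 0"
    using int_mul_add[of "n * k" "- k" a] by (simp add: int_mul_uminus)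
  then have "n * k - k = 0"
    using torsion_free_int_mul[OF tf] \<open>a \<noteq> 0\<close> by blast
  then have "k = 0" using \<open>n \<noteq> 1\<close> by (simp add: algebra_simps)
  with km have "int_mul m t = 0" "m > 0" by auto
  then show False using torsion_free_int_mul[OF tf, of m t] \<open>t \<noteq> 0\<close> by simp
qed

lemma zero_notin_positive_sums_bs:
  fixes a t :: "'g::group_add"
  assumes "torsion_free TYPE('g)" "a \<noteq> 0" "t \<noteq> 0" "n \<noteq> 1"
    and "t + a = int_mul n a + t" "S \<subseteq> bs_cone a t"
  shows "0 \<notin> positive_sums S"
  using positive_sums_subset[OF assms(6) bs_cone_add[OF assms(5)]] zero_notin_bs_cone[OF assms(1-5)]
  by blast

section \<open>The case of commuting generators\<close>

lemma int_mul_commute: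
  assumes "x + y = y + x"
  shows "int_mul k x + int_mul l y = int_mul l y + int_mul k x"
  using int_mul_conj[OF int_mul_conj[OF assms, symmetric], symmetric] .

lemma int_mul_add_pair:
  assumes "x + y = y + x"
  shows "(int_mul k x + int_mul l y) + (int_mul k' x + int_mul l' y)
       = int_mul (k + k') x + int_mul (l + l') y"
proof -
  have "(int_mul k x + int_mul l y) + (int_mul k' x + int_mul l' y)
      = int_mul k x + (int_mul l y + int_mul k' x) + int_mul l' y"
    by (simp only: add.assoc)
  also have "\<dots> = int_mul k x + (int_mul k' x + int_mul l y) + int_mul l' y"
    by (simp only: int_mul_commute[OF assms])
  finally show ?thesis by (simp only: int_mul_add add.assoc)
qed

text \<open>A relation i x + j y = 0 with i, j > 0 makes the form k j - l i well defined on the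
  elements k x + l y. The form is negative on \<open>- x\<close> and on \<open>- x + y\<close>,
  hence on every positive sum of them.\<close>

lemma no_zero_sums_commute:
  fixes x y :: "'g::group_add"
  assumes tf: "torsion_free TYPE('g)" and "x \<noteq> 0" "y \<noteq> 0" and comm: "x + y = y + x"
    and "0 \<in> positive_sums {x, y}"
  shows "0 \<notin> positive_sums {- x, - x + y}"
proof -
  let ?P = "{int_mul k x + int_mul l y | k l. k \<ge> 0 \<and> l \<ge> 0 \<and> k + l > 0}"
  have "positive_sums {x, y} \<subseteq> ?P"
  proof (rule positive_sums_subset)
    have "x \<in> ?P" by (intro CollectI exI[of _ 1] exI[of _ 0]) simp
    moreover have "y \<in> ?P" by (intro CollectI exI[of _ 0] exI[of _ 1]) simp
    ultimately show "{x, y} \<subseteq> ?P" by blast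
  next
    fix u v assume "u \<in> ?P" "v \<in> ?P"
    then obtain k l k' l' where "u = int_mul k x + int_mul l y" "k \<ge> 0 \<and> l \<ge> 0 \<and> k + l > 0"
      "v = int_mul k' x + int_mul l' y" "k' \<ge> 0 \<and> l' \<ge> 0 \<and> k' + l' > 0" by blast
    then show "u + v \<in> ?P"
      by (intro CollectI exI[of _ "k + k'"] exI[of _ "l + l'"])
        (simp add: int_mul_add_pair[OF comm])
  qed
  with assms(5) obtain i j where ij: "i \<ge> 0" "j \<ge> 0" "i + j > 0"
    "int_mul i x + int_mul j y = 0" using assms(5) by (smt (verit, best) mem_Collect_eq subsetD)
  have "i \<noteq> 0" "j \<noteq> 0"
    using ij torsion_free_int_mul[OF tf, of i x] torsion_free_int_mul[OF tf, of j y]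
      \<open>x \<noteq> 0\<close> \<open>y \<noteq> 0\<close> by auto
  let ?Q = "{int_mul k x + int_mul l y | k l. k * j - l * i < 0}"
  have "positive_sums {- x, - x + y} \<subseteq> ?Q"
  proof (rule positive_sums_subset)
    have "- x \<in> ?Q"
      using ij \<open>j \<noteq> 0\<close> by (intro CollectI exI[of _ "- 1"] exI[of _ 0]) simp
    moreover have "- x + y \<in> ?Q"
      using ij \<open>j \<noteq> 0\<close> by (intro CollectI exI[of _ "- 1"] exI[of _ 1]) simp
    ultimately show "{- x, - x + y} \<subseteq> ?Q" by blast
  next
    fix u v assume "u \<in> ?Q" "v \<in> ?Q"
    then obtain k l k' l' where "u = int_mul k x + int_mul l y" "k * j - l * i < 0"
      "v = int_mul k' x + int_mul l' y" "k' * j - l' * i < 0" by blast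
    then have "u + v = int_mul (k + k') x + int_mul (l + l') y" "(k + k') * j - (l + l') * i < 0"
      by (simp_all only: int_mul_add_pair[OF comm]) (simp add: algebra_simps)
    then show "u + v \<in> ?Q" by blast
  qed
  moreover have "0 \<notin> ?Q"
  proof
    assume "0 \<in> ?Q"
    then obtain k l where kl: "int_mul k x + int_mul l y = 0" "k * j - l * i < 0"
      by (smt (verit, best) mem_Collect_eq)
    have scale: "int_mul m (int_mul k x + int_mul l y) = int_mul (m * k) x + int_mul (m * l) y"
      for m k l
    proof (induction m rule: int_induct[where k = 0])
      case (step1 m)
      have "(m + 1) * k = k + m * k" "(m + 1) * l = l + m * l" by (simp_all add: algebra_simps)
      with step1 show ?case
        by (simp only: int_mul_add_one int_mul_add_pair[OF comm])
    next
      case (step2 m)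
      have "- (int_mul k x + int_mul l y) = int_mul (- k) x + int_mul (- l) y"
        using int_mul_add_pair[OF comm, of k l "- k" "- l"] by (simp add: minus_unique)
      moreover have "(m - 1) * k = - k + m * k" "(m - 1) * l = - l + m * l"
        by (simp_all add: algebra_simps)
      ultimately show ?case
        using step2 by (simp only: int_mul_diff_one int_mul_add_pair[OF comm])
    qed simp
    \<comment> \<open>Elimination of \<open>y\<close> between the two relations, as in Cramer's
      rule.\<close>
    have "int_mul (k * j - l * i) x
        = int_mul j (int_mul k x + int_mul l y) + int_mul (- l) (int_mul i x + int_mul j y)"
      by (simp only: scale int_mul_add_pair[OF comm]) (simp add: algebra_simps)
    then have "int_mul (k * j - l * i) x = 0"
      using kl ij by simp
    then show False using torsion_free_int_mul[OF tf, of "k * j - l * i" x] kl \<open>x \<noteq> 0\<close> by simp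
  qed
  ultimately show ?thesis by blast
qed

section \<open>Relations excluded in a three-element set without unique products\<close>

text \<open>A closed walk \<open>h + g = h' + g'\<close>, \<open>k + g' = k' + g''\<close>, \<open>\<dots>\<close> in a zero-divisor graph makes the
  alternating sum of \<open>[h, h', k, k', \<dots>]\<close> vanish.  Only lists of even length matter.\<close>

fun alt_sum :: "'g::group_add list \<Rightarrow> 'g" where
  "alt_sum (p # q # l) = - p + q + alt_sum l"
| "alt_sum _ = 0"

text \<open>\<open>S\<close> stands for the support of \<alpha>. Of the equation \<alpha>\<beta> = 0
  only \<open>zero_sum\<close> is retained: one trivial nonempty product at each corner
  \<open>h\<close>.\<close>

locale no_unique_product =
  fixes S :: "'g::group_add set"
  assumes tf: "torsion_free TYPE('g)"
    and card_S: "card S = 3"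
    and zero_sum: "h \<in> S \<Longrightarrow> 0 \<in> positive_sums ((\<lambda>h'. - h' + h) ` (S - {h}))"
begin

lemma S_eq:
  assumes "distinct [a, b, c]" "set [a, b, c] \<subseteq> S"
  shows "S = {a, b, c}"
proof -
  have "card {a, b, c} = 3" using assms(1) by simp
  then show ?thesis
    using card_subset_eq[of S "{a, b, c}"] assms(2) card_S
    by (metis card.infinite list.set(1,2) zero_neq_numeral)
qed

lemma zero_sum_corner:
  assumes "distinct [a, b, c]" "set [a, b, c] \<subseteq> S"
  shows "0 \<in> positive_sums {- b + a, - c + a}"
proof -
  have "S = {a, b, c}" using S_eq[OF assms] .
  then have "S - {a} = {b, c}" using assms(1) by auto
  then show ?thesis using zero_sum[of a] assms(2) by simp
qed

text \<open>The corners \<open>a\<close> and \<open>a + x\<close>, after negation, give 0 as a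
  positive sum over {x, y} and over {- x, - x + y}; commuting generators do not admit both.\<close>

lemma not_commute:
  assumes "distinct [a, a + x, a + y]" "set [a, a + x, a + y] \<subseteq> S"
  shows "x + y \<noteq> y + x"
proof
  assume comm: "x + y = y + x"
  have "0 \<in> positive_sums {- x, - y}"
    using zero_sum_corner[OF assms] by (simp add: minus_add add.assoc)
  from positive_sums_uminus[OF this] have "0 \<in> positive_sums {x, y}" by simp
  moreover have "0 \<in> positive_sums {x, - y + x}"
    using zero_sum_corner[of "a + x" a "a + y"] assms
    by (auto simp add: minus_add add.assoc insert_commute diff_conv_add_uminus
        simp del: add_uminus_conv_diff)
  from positive_sums_uminus[OF this] have "0 \<in> positive_sums {- x, - x + y}"
    by (simp add: minus_add)
  moreover have "x \<noteq> 0" "y \<noteq> 0" using assms(1) by auto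
  ultimately show False
    using no_zero_sums_commute[OF tf _ _ comm] by simp
qed

text \<open>Both \<open>x\<close> and \<open>y\<close> lie in the cone of the Baumslag-Solitar
  relation, against the negated zero sum at the corner \<open>a\<close>.\<close>

lemma not_bs:
  assumes "distinct [a, a + x, a + y]" "set [a, a + x, a + y] \<subseteq> S" "n \<noteq> 1"
  shows "y + x \<noteq> int_mul n x + y"
proof
  assume rel: "y + x = int_mul n x + y"
  have "x \<noteq> 0" "y \<noteq> 0" using assms(1) by auto
  have "0 \<in> positive_sums {- x, - y}"
    using zero_sum_corner[OF assms(1,2)] by (simp add: minus_add add.assoc)
  from positive_sums_uminus[OF this] have "0 \<in> positive_sums {x, y}" by simp
  moreover have "x \<in> bs_cone x y"
    unfolding bs_cone_def by (intro CollectI exI[of _ 1] exI[of _ 0]) simp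
  moreover have "y \<in> bs_cone x y"
    unfolding bs_cone_def by (intro CollectI exI[of _ 0] exI[of _ 1]) simp
  ultimately show False
    using zero_notin_positive_sums_bs[OF tf _ _ assms(3) rel, of "{x, y}"] \<open>x \<noteq> 0\<close> \<open>y \<noteq> 0\<close> by auto
qed

text \<open>Here the conjugating element is inverted: y^-1 x y = x^n. In terms of \<open>- x\<close>
  and \<open>- y\<close>, the generators at the corner \<open>a\<close>, this is a cone
  relation.\<close>

lemma not_bs':
  assumes "distinct [a, a + x, a + y]" "set [a, a + x, a + y] \<subseteq> S" "n \<noteq> 1"
  shows "x + y \<noteq> y + int_mul n x"
proof
  assume rel0: "x + y = y + int_mul n x"
  have "x \<noteq> 0" "y \<noteq> 0" using assms(1) by auto
  from rel0 have "- y + x = int_mul n x + - y"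
    by (metis add.assoc add_minus_cancel minus_add_cancel right_minus add.right_neutral)
  from int_mul_conj[OF this, of "- 1"] have rel: "- y + - x = int_mul n (- x) + - y"
    using int_mul_mult[of n "- 1" x] int_mul_mult[of "- 1" n x] by simp
  have "0 \<in> positive_sums {- x, - y}"
    using zero_sum_corner[OF assms(1,2)] by (simp add: minus_add add.assoc)
  moreover have "- x \<in> bs_cone (- x) (- y)"
    unfolding bs_cone_def by (intro CollectI exI[of _ 1] exI[of _ 0]) simp
  moreover have "- y \<in> bs_cone (- x) (- y)"
    unfolding bs_cone_def by (intro CollectI exI[of _ 0] exI[of _ 1]) simp
  ultimately show False
    using zero_notin_positive_sums_bs[OF tf _ _ assms(3) rel, of "{- x, - y}"] \<open>x \<noteq> 0\<close> \<open>y \<noteq> 0\<close>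
      by auto
qed

text \<open>The Klein bottle relation: for s = y x it reads y s y^-1 = s^-1. Since \<open>x\<close>
  and \<open>y\<close> have opposite heights, the corner \<open>a + x\<close> is used; its negated
  generators are - s + y and - s + 2 y, both in the cone.\<close>

lemma not_klein:
  assumes "distinct [a, a + x, a + y]" "set [a, a + x, a + y] \<subseteq> S"
  shows "x + x + y + y \<noteq> 0"
proof
  assume *: "x + x + y + y = 0"
  have "x \<noteq> 0" "y \<noteq> 0" using assms(1) by auto
  define s where "s = y + x"
  have "y + s = - x"
    using * unfolding s_def
      by (metis add.assoc add_minus_cancel minus_add_cancel eq_neg_iff_add_eq_0 neg_eq_iff_add_eq_0)
  then have rel: "y + s = int_mul (- 1) s + y"
    by (simp add: s_def minus_add add.assoc)
  have "x + y \<noteq> y + x" using not_commute[OF assms] .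
  then have "s \<noteq> 0" unfolding s_def by (metis add.assoc add_0 add.right_neutral add_left_cancel)
  have "0 \<in> positive_sums {x, - y + x}"
    using zero_sum_corner[of "a + x" a "a + y"] assms
    by (auto simp add: minus_add add.assoc insert_commute diff_conv_add_uminus
        simp del: add_uminus_conv_diff)
  from positive_sums_uminus[OF this] have "0 \<in> positive_sums {- x, - x + y}"
    by (simp add: minus_add)
  moreover have "- x \<in> bs_cone s y"
    unfolding bs_cone_def
      by (intro CollectI exI[of _ "- 1"] exI[of _ 1]) (simp add: s_def minus_add add.assoc)
  moreover have "- x + y \<in> bs_cone s y"
    unfolding bs_cone_def
      by (rule CollectI, rule exI[of _ "- 1"], rule exI[of _ 2])
        (simp add: s_def minus_add add.assoc int_mul_2 diff_conv_add_uminus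
          del: add_uminus_conv_diff)
  ultimately show False
    using zero_notin_positive_sums_bs[OF tf \<open>s \<noteq> 0\<close> \<open>y \<noteq> 0\<close> _ rel, of "{- x, - x + y}"] by simp
qed

text \<open>With x = - a + b and y = - a + c each walk becomes a word that is a multiple of x or of
  x + y, expresses y by x, is a commutator or a Klein bottle relation, or rearranges to a
  Baumslag-Solitar relation. The words are representatives up to renaming, rotation and
  reversal.\<close>

lemma excluded:
  assumes d: "distinct [a, b, c]" "set [a, b, c] \<subseteq> S"
  shows "alt_sum [a, b, a, b] \<noteq> 0"
    and "alt_sum [a, b, a, c] \<noteq> 0"
    and "alt_sum [a, b, a, b, a, b] \<noteq> 0"
    and "alt_sum [a, b, a, b, a, c] \<noteq> 0"
    and "alt_sum [a, b, a, c, b, c] \<noteq> 0"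
    and "alt_sum [a, b, c, a, b, c] \<noteq> 0"
    and "alt_sum [a, b, a, b, a, b, a, b] \<noteq> 0"
    and "alt_sum [a, b, a, b, a, b, a, c] \<noteq> 0"
    and "alt_sum [a, b, a, b, a, c, a, c] \<noteq> 0"
    and "alt_sum [a, b, a, b, c, a, b, c] \<noteq> 0"
    and "alt_sum [a, b, a, b, c, b, a, c] \<noteq> 0"
    and "alt_sum [a, b, a, c, a, b, a, c] \<noteq> 0"
    and "alt_sum [a, b, a, c, a, b, c, b] \<noteq> 0"
    and "alt_sum [a, b, a, c, b, a, c, b] \<noteq> 0"
proof -
  define x y where "x = - a + b" and "y = - a + c"
  then have bc: "b = a + x" "c = a + y" by (simp_all add: add.assoc[symmetric])
  have d': "distinct [a, a + x, a + y]" "set [a, a + x, a + y] \<subseteq> S"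
    "distinct [a, a + y, a + x]" "set [a, a + y, a + x] \<subseteq> S"
    using d by (auto simp: bc)
  have "x \<noteq> 0" "y \<noteq> 0" using d' by auto
  have tors: "int_mul k x \<noteq> 0" if "k \<noteq> 0" for k
    using torsion_free_int_mul[OF tf _ that] \<open>x \<noteq> 0\<close> by blast
  have tors': "z = 0" if "z + z = 0" for z :: 'g
    using torsion_free_int_mul[OF tf, of 2 z] that by (simp add: int_mul_2)
  note comm = not_commute[OF d'(1,2)]
  have comm1: "int_mul k x + y \<noteq> 0" for k
  proof
    assume "int_mul k x + y = 0"
    then have "y = int_mul (- k) x" by (simp add: int_mul_uminus minus_unique)
    then show False using comm int_mul_commute[of x x 1 "- k"] by simp
  qed
  \<comment> \<open>For every n other than 1 these rule out y x y^-1 = x^n, x y x^-1 = y^n and y^-1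
    x y = x^n, in this order.\<close>
  note bs = not_bs[OF d'(1,2)] not_bs[OF d'(3,4)] not_bs'[OF d'(1,2)]
  have int3: "int_mul 3 x = x + (x + x)"
    using int_mul_add[of 1 2 x] by (simp add: int_mul_2)
  have int4: "int_mul 4 x = x + (x + (x + x))"
    using int_mul_add[of 2 2 x] by (simp add: int_mul_2 add.assoc)
  note wd = bc minus_add add.assoc diff_conv_add_uminus
  show "alt_sum [a, b, a, b] \<noteq> 0"
    using tors[of 2] by (simp del: add_uminus_conv_diff add: wd int_mul_2)
  show "alt_sum [a, b, a, c] \<noteq> 0"
    using comm1[of 1] by (simp del: add_uminus_conv_diff add: wd)
  show "alt_sum [a, b, a, b, a, b] \<noteq> 0"
    using tors[of 3] by (simp del: add_uminus_conv_diff add: wd int3)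
  show "alt_sum [a, b, a, b, a, c] \<noteq> 0"
    using comm1[of 2] by (simp del: add_uminus_conv_diff add: wd int_mul_2)
  show "alt_sum [a, b, a, c, b, c] \<noteq> 0"
  proof
    assume "alt_sum [a, b, a, c, b, c] = 0"
    then have *: "x + (y + (- x + y)) = 0" by (simp del: add_uminus_conv_diff add: wd)
    then have "x + (y + (- x + y)) + (- y + x) = - y + x" by simp
    then have "x + y = - y + x" by (simp add: add.assoc)
    then show False using bs(2)[of "- 1"] by simp
  qed
  show "alt_sum [a, b, c, a, b, c] \<noteq> 0"
  proof
    assume "alt_sum [a, b, c, a, b, c] = 0"
    then have "x + (- y + (- x + y)) = 0" by (simp del: add_uminus_conv_diff add: wd)
    then have "x + (- y + (- x + y)) + (- y + (x + y)) = - y + (x + y)" by simp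
    then have "x = - y + (x + y)" by (simp add: add.assoc)
    then have "y + x = x + y" by (metis add_minus_cancel)
    then show False using comm by simp
  qed
  show "alt_sum [a, b, a, b, a, b, a, b] \<noteq> 0"
    using tors[of 4] by (simp del: add_uminus_conv_diff add: wd int4)
  show "alt_sum [a, b, a, b, a, b, a, c] \<noteq> 0"
    using comm1[of 3] by (simp del: add_uminus_conv_diff add: wd int3)
  show "alt_sum [a, b, a, b, a, c, a, c] \<noteq> 0"
    using not_klein[OF d'(1,2)] by (simp del: add_uminus_conv_diff add: wd)
  show "alt_sum [a, b, a, c, a, b, a, c] \<noteq> 0"
    using tors'[of "x + y"] comm1[of 1] by (auto simp: wd simp del: add_uminus_conv_diff)
  show "alt_sum [a, b, a, b, c, a, b, c] \<noteq> 0"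
  proof
    assume "alt_sum [a, b, a, b, c, a, b, c] = 0"
    then have "x + (x + (- y + (- x + y))) = 0" by (simp del: add_uminus_conv_diff add: wd)
    then have "x + (x + (- y + (- x + y))) + (- y + x + y) = - y + x + y" by simp
    then have "x + x = - y + (x + y)" by (simp add: add.assoc)
    then have "y + (x + x) = x + y" by (metis add_minus_cancel)
    then show False using bs(3)[of 2] by (simp add: int_mul_2)
  qed
  show "alt_sum [a, b, a, b, c, b, a, c] \<noteq> 0"
  proof
    assume "alt_sum [a, b, a, b, c, b, a, c] = 0"
    then have "x + (x + (- y + (x + y))) = 0" by (simp del: add_uminus_conv_diff add: wd)
    then have "- y + (x + y) = - (x + x)" by (metis add.assoc minus_unique)
    then have "x + y = y + (- x + - x)" by (metis add_minus_cancel minus_add)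
    then show False using bs(3)[of "- 2"] by (simp add: int_mul_minus2)
  qed
  show "alt_sum [a, b, a, c, a, b, c, b] \<noteq> 0"
  proof
    assume "alt_sum [a, b, a, c, a, b, c, b] = 0"
    then have "x + (y + (x + (- y + x))) = 0" by (simp del: add_uminus_conv_diff add: wd)
    then have "y + (x + (- y + x)) = - x" by (metis minus_unique)
    then have "y + x + - y = - x + - x"
      by (metis add.assoc add_minus_cancel add.right_neutral right_minus)
    then have "y + x = - x + - x + y" by (simp add: diff_eq_eq)
    then show False using bs(1)[of "- 2"] by (simp add: int_mul_minus2)
  qed
  show "alt_sum [a, b, a, c, b, a, c, b] \<noteq> 0"
  proof
    assume "alt_sum [a, b, a, c, b, a, c, b] = 0"
    then have "x + (y + (- x + (- y + x))) = 0" by (simp del: add_uminus_conv_diff add: wd)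
    then have "y + (- x + (- y + x)) = - x" by (metis minus_unique)
    then have "y + (- x + - y) = - x + - x"
      by (metis add.assoc add_minus_cancel add.right_neutral right_minus)
    then have "y + - x = - x + - x + y" by (simp add: add_diff_eq diff_eq_eq)
    \<comment> \<open>Inversion turns y x^-1 y^-1 = x^-2 into y x y^-1 = x^2.\<close>
    from int_mul_conj[OF this, of "- 1"] have "y + x = x + x + y" by (simp add: minus_add)
    then show False using bs(1)[of 2] by (simp add: int_mul_2)
  qed
qed

end

section \<open>Words of closed walks with two, three and four edges\<close>

text \<open>The pairs \<open>(k, l)\<close> for which the 4-cycle relation \<open>alt_sum (a # k) = alt_sum (b # l)\<close> does not
  contradict torsion-freeness and \<open>zero_sum\<close> below; the group it presents is the trefoil group.\<close>

definition word_pairs :: "'a \<Rightarrow> 'a \<Rightarrow> 'a \<Rightarrow> ('a list \<times> 'a list) set" where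
  "word_pairs a b c =
    {([b, a, b], [c, a, c]), ([b, a, c], [a, c, b]), ([b, c, a], [a, b, c]),
     ([b, c, a], [c, a, b]), ([b, c, a], [c, a, c]), ([c, a, b], [c, a, c]),
     ([c, a, b], [c, b, c]), ([c, a, c], [c, b, a]), ([c, b, a], [a, c, b]),
     ([c, b, c], [a, b, a]), ([c, b, c], [a, c, b]), ([c, b, c], [c, b, a])}"

text \<open>Three paths with common ends have words that match pairwise. Comparing the three tables
  leaves only the two cyclic patterns abca, bcab, cabc and acba, bacb, cbac, where the leading
  letters \<open>a\<close>, \<open>b\<close>, \<open>c\<close> are put back.\<close>

lemma word_pairs_compatible:
  assumes dist: "distinct [a, b, c]" and ab: "(k, l) \<in> word_pairs a b c"
    and ac: "(k, m) \<in> word_pairs a c b" and bc: "(l, m) \<in> word_pairs b c a"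
  shows "(k, l, m) \<in> {([b, c, a], [c, a, b], [a, b, c]), ([c, b, a], [a, c, b], [b, a, c])}"
proof -
  have "\<forall>(k, l) \<in> word_pairs a b c. \<forall>(k', m) \<in> word_pairs a c b. k = k' \<longrightarrow>
      (l, m) \<in> word_pairs b c a \<longrightarrow>
      (k, l, m) \<in> {([b, c, a], [c, a, b], [a, b, c]), ([c, b, a], [a, c, b], [b, a, c])}"
    using dist by (simp add: word_pairs_def) auto
  from bspec[OF bspec[OF this ab, unfolded prod.case] ac, unfolded prod.case] bc
  show ?thesis by blast
qed

lemma alt_sum_append: "even (length l) \<Longrightarrow> alt_sum (l @ l') = alt_sum l + alt_sum l'"
  by (induction l rule: alt_sum.induct) (auto simp: add.assoc)

text \<open>Rotation by a whole pair conjugates the sum, so a closed walk may start at any of its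
  vertices.\<close>

lemma alt_sum_rotate:
  assumes "alt_sum (p # q # l) = 0" "even (length l)"
  shows "alt_sum (l @ [p, q]) = 0"
  using assms
    by (simp add: alt_sum_append)
      (metis neg_eq_iff_add_eq_0 add_eq_0_iff add.assoc minus_minus right_minus)

text \<open>The reversed list is the walk traversed backwards.\<close>

lemma alt_sum_rev: "even (length l) \<Longrightarrow> alt_sum (rev l) = - alt_sum l"
  by (induction l rule: alt_sum.induct)
      (auto simp: alt_sum_append minus_add add.assoc diff_conv_add_uminus
        simp del: add_uminus_conv_diff)

context no_unique_product
begin

lemma third_element:
  assumes "a \<in> S" "b \<in> S" "a \<noteq> b"
  obtains c where "distinct [a, b, c]" "S = {a, b, c}"
proof -
  have "card (S - {a, b}) = 1"
    using assms card_S by (subst card_Diff_subset) auto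
  then obtain c where "S - {a, b} = {c}" using card_1_singletonE by blast
  then show ?thesis using assms that[of c] by auto
qed

context
  fixes a b c
  assumes S: "S = {a, b, c}" and dist: "distinct [a, b, c]"
begin

lemma perms_in_S:
  "distinct [a, c, b]" "distinct [b, a, c]" "distinct [b, c, a]" "distinct [c, a, b]"
  "distinct [c, b, a]" "set [a, b, c] \<subseteq> S" "set [a, c, b] \<subseteq> S" "set [b, a, c] \<subseteq> S"
  "set [b, c, a] \<subseteq> S" "set [c, a, b] \<subseteq> S" "set [c, b, a] \<subseteq> S"
  using S dist by auto

lemmas excluded_perms = excluded[OF dist perms_in_S(6)] excluded[OF perms_in_S(1,7)]
  excluded[OF perms_in_S(2,8)]
  excluded[OF perms_in_S(3,9)] excluded[OF perms_in_S(4,10)] excluded[OF perms_in_S(5,11)]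

text \<open>The membership conditions say that cyclic neighbours differ. Rotating and reversing such
  a word produces one of the excluded words in some naming of \<open>S\<close>.\<close>

lemma closed_walk4:
  assumes "r \<in> {a, c}" "s \<in> {b, c}" "r \<noteq> s"
  shows "alt_sum [a, b, r, s] \<noteq> 0"
  using assms alt_sum_rotate[of a b "[r, s]"] alt_sum_rev[of "[a, b, r, s]"]
    alt_sum_rev[of "[r, s, a, b]"] excluded_perms dist
  by (auto simp del: alt_sum.simps)

lemma closed_walk6:
  assumes h: "r \<in> {a, c}" "s \<in> S" "t \<in> S" "u \<in> {b, c}" "r \<noteq> s" "s \<noteq> t" "t \<noteq> u"
  shows "alt_sum [a, b, r, s, t, u] \<noteq> 0"
proof
  assume 0: "alt_sum [a, b, r, s, t, u] = 0"
  then have 1: "alt_sum [r, s, t, u, a, b] = 0"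
    using alt_sum_rotate[of a b "[r, s, t, u]"] by (simp del: alt_sum.simps)
  then have 2: "alt_sum [t, u, a, b, r, s] = 0"
    using alt_sum_rotate[of r s "[t, u, a, b]"] by (simp del: alt_sum.simps)
  have 3: "alt_sum [u, t, s, r, b, a] = 0" "alt_sum [b, a, u, t, s, r] = 0"
    "alt_sum [s, r, b, a, u, t] = 0"
    using 0 1 2 alt_sum_rev[of "[a, b, r, s, t, u]"] alt_sum_rev[of "[r, s, t, u, a, b]"]
      alt_sum_rev[of "[t, u, a, b, r, s]"] by (simp_all del: alt_sum.simps)
  show False
    using h 0 1 2 3 unfolding S
    by (elim insertE emptyE; hypsubst; simp del: alt_sum.simps add: excluded_perms dist)
qed

text \<open>The word is the path a q r s followed by the reverse of b v u t, so its vanishing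
  equates the sums of the two paths.\<close>

lemma closed_walk8:
  assumes h: "q \<in> {b, c}" "{r, s, t, u} \<subseteq> S" "v \<in> {a, c}"
      "q \<noteq> r" "r \<noteq> s" "s \<noteq> t" "t \<noteq> u" "u \<noteq> v"
    and 0: "alt_sum [a, q, r, s, t, u, v, b] = 0"
  shows "([q, r, s], [v, u, t]) \<in> word_pairs a b c"
proof -
  have 1: "alt_sum [r, s, t, u, v, b, a, q] = 0"
    using 0 alt_sum_rotate[of a q "[r, s, t, u, v, b]"] by (simp del: alt_sum.simps)
  have 2: "alt_sum [t, u, v, b, a, q, r, s] = 0"
    using 1 alt_sum_rotate[of r s "[t, u, v, b, a, q]"] by (simp del: alt_sum.simps)
  have 3: "alt_sum [v, b, a, q, r, s, t, u] = 0"
    using 2 alt_sum_rotate[of t u "[v, b, a, q, r, s]"] by (simp del: alt_sum.simps)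
  note rot = 0 1 2 3
  have rev: "alt_sum [b, v, u, t, s, r, q, a] = 0" "alt_sum [q, a, b, v, u, t, s, r] = 0"
    "alt_sum [s, r, q, a, b, v, u, t] = 0" "alt_sum [u, t, s, r, q, a, b, v] = 0"
    using rot[THEN arg_cong[where f = uminus]]
    by (simp_all del: alt_sum.simps flip: alt_sum_rev)
  have qrs: "(q, r, s) \<in> {(b, a, b), (b, a, c), (b, c, a), (b, c, b), (c, a, b), (c, a, c),
      (c, b, a), (c, b, c)}"
    using h(1-6) S by auto
  have vut: "(v, u, t) \<in> {(a, b, a), (a, b, c), (a, c, a), (a, c, b), (c, a, b), (c, a, c),
      (c, b, a), (c, b, c)}"
    using h(2,3,6-8) S by auto
  \<comment> \<open>The eight equations are all rotations and reversals of one word. Every case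
    outside the table has an excluded word among them.\<close>
  have "\<forall>(q, r, s) \<in> {(b, a, b), (b, a, c), (b, c, a), (b, c, b), (c, a, b), (c, a, c),
      (c, b, a), (c, b, c)}.
    \<forall>(v, u, t) \<in> {(a, b, a), (a, b, c), (a, c, a), (a, c, b), (c, a, b), (c, a, c),
      (c, b, a), (c, b, c)}. s \<noteq> t \<longrightarrow>
    alt_sum [a, q, r, s, t, u, v, b] = 0 \<and> alt_sum [r, s, t, u, v, b, a, q] = 0 \<and>
    alt_sum [t, u, v, b, a, q, r, s] = 0 \<and> alt_sum [v, b, a, q, r, s, t, u] = 0 \<and>
    alt_sum [b, v, u, t, s, r, q, a] = 0 \<and> alt_sum [q, a, b, v, u, t, s, r] = 0 \<and>
    alt_sum [s, r, q, a, b, v, u, t] = 0 \<and> alt_sum [u, t, s, r, q, a, b, v] = 0 \<longrightarrow>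
    ([q, r, s], [v, u, t]) \<in> word_pairs a b c"
    by (simp del: alt_sum.simps add: excluded_perms word_pairs_def)
  note bspec[OF bspec[OF this qrs, unfolded prod.case] vut, unfolded prod.case]
  then show "([q, r, s], [v, u, t]) \<in> word_pairs a b c"
    by (elim mp[OF mp]) (intro \<open>s \<noteq> t\<close> conjI rot rev)+
qed

end

end

section \<open>Triangles, and three paths between two vertices\<close>

text \<open>The two relations present \<open>SL(2,3)\<close>: they imply the braid relation and make \<open>3p\<close> central.\<close>

lemma mutual_conjugate_torsion:
  fixes p q :: "'g::group_add"
  assumes 1: "p + q + q + p = q" and 2: "q + p + p + q = p"
  shows "int_mul 6 p = 0"
proof -
  \<comment> \<open>Substituting q p p q for the first p in p q p gives q p (p q q p) = q p
    q.\<close>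
  have braid: "q + p + q = p + q + p"
    using 1 2 by (metis add.assoc)
  define z where "z = p + p + p"
  \<comment> \<open>Expanding the last and then the first p of p^3 by the second relation shows p^3
    = (p q)^3 = (q p)^3. Since q (p q)^3 = (q p)^3 q, \<open>z\<close> commutes with
    \<open>q\<close>.\<close>
  have "z = p + p + (q + p + p + q)" by (simp add: z_def 2)
  also have "\<dots> = p + (p + q + p) + p + q" by (simp add: add.assoc)
  also have "\<dots> = p + (q + p + q) + p + q" by (simp only: braid)
  also have "\<dots> = p + q + p + q + p + q" by (simp add: add.assoc)
  finally have z1: "z = p + q + p + q + p + q" .
  have "z = (q + p + p + q) + p + p" by (simp add: z_def 2)
  also have "\<dots> = q + p + (p + q + p) + p" by (simp add: add.assoc)
  also have "\<dots> = q + p + (q + p + q) + p" by (simp only: braid)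
  also have "\<dots> = q + p + q + p + q + p" by (simp add: add.assoc)
  finally have comm: "z + q = q + z" using z1 by (simp add: add.assoc)
  \<comment> \<open>The braid relation rewrites q^2 as p^2 q p^2; the first relation then gives q =
    z q z.\<close>
  have "q + q = (p + q + q + p) + q" by (simp add: 1)
  also have "\<dots> = p + q + (q + p + q)" by (simp add: add.assoc)
  also have "\<dots> = p + q + (p + q + p)" by (simp only: braid)
  also have "\<dots> = p + (q + p + q) + p" by (simp add: add.assoc)
  also have "\<dots> = p + (p + q + p) + p" by (simp only: braid)
  finally have "p + (q + q) + p = z + q + z" by (simp add: z_def add.assoc)
  then have "q = z + q + z" using 1 by (simp add: add.assoc)
  also have "\<dots> = q + z + z" by (simp only: comm)
  finally have "q + (z + z) = q + 0" by (simp add: add.assoc)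
  then have "z + z = 0" by (simp only: add_left_cancel)
  moreover have "int_mul 6 p = z + z"
    using int_mul_add[of 3 3 p] int_mul_add[of 2 1 p] by (simp add: z_def int_mul_2)
  ultimately show ?thesis by simp
qed

lemma uminus_add_eq_0_iff: "- x + y = 0 \<longleftrightarrow> x = y" for x y :: "'g::group_add"
  using neg_eq_iff_add_eq_0[of "- x" y] by simp

context no_unique_product
begin

lemma closed4:
  assumes "{p, q, r, s} \<subseteq> S" "p \<noteq> q" "q \<noteq> r" "r \<noteq> s" "s \<noteq> p"
  shows "alt_sum [p, q, r, s] \<noteq> 0"
proof -
  obtain c where c: "distinct [p, q, c]" "S = {p, q, c}"
    using third_element[of p q] assms by auto
  show ?thesis
    using assms c by (intro closed_walk4[OF c(2,1)]) auto
qed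

lemma closed6:
  assumes "{p, q, r, s, t, u} \<subseteq> S" "p \<noteq> q" "q \<noteq> r" "r \<noteq> s" "s \<noteq> t" "t \<noteq> u" "u \<noteq> p"
  shows "alt_sum [p, q, r, s, t, u] \<noteq> 0"
proof -
  obtain c where c: "distinct [p, q, c]" "S = {p, q, c}"
    using third_element[of p q] assms by auto
  show ?thesis
    using assms c by (intro closed_walk6[OF c(2,1)]) auto
qed

text \<open>Without a coincidence at a junction the walk is excluded by \<open>closed6\<close>. A
  coincidence cancels a pair and leaves four letters, for which \<open>closed4\<close> forces a
  second one, and the two letters left give the third. All three edges then come from one
  coefficient of \<alpha>\<beta>, and their labels exhaust \<open>S\<close>.\<close>

lemma triangle_degenerate:
  assumes in_S: "{p, q, r, s, t, u} \<subseteq> S" and ne: "p \<noteq> q" "r \<noteq> s" "t \<noteq> u"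
    and 0: "alt_sum [p, q, r, s, t, u] = 0"
  shows "q = r \<and> s = t \<and> u = p"
proof -
  have *: "alt_sum [r, s, t, u, p, q] = 0" "alt_sum [t, u, p, q, r, s] = 0"
    using 0 alt_sum_rotate[of p q "[r, s, t, u]"] alt_sum_rotate[of r s "[t, u, p, q]"]
    by (simp_all del: alt_sum.simps)
  have step: "s = t \<and> u = p"
    if "{p, q, s, t, u} \<subseteq> S" "p \<noteq> q" "q \<noteq> s" "t \<noteq> u" "alt_sum [p, q, q, s, t, u] = 0"
    for p q s t u
  proof -
    have 4: "alt_sum [p, s, t, u] = 0" using that by (simp add: add.assoc)
    show ?thesis
    proof (cases "p = s")
      case True
      with 4 \<open>t \<noteq> u\<close> show ?thesis by (simp add: uminus_add_eq_0_iff)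
    next
      case False
      then have "s = t \<or> u = p"
        using closed4[of p s t u] that 4 by blast
      then show ?thesis
        using 4 alt_sum_rotate[of p s "[t, u]"]
        by (elim disjE) (simp_all add: add.assoc uminus_add_eq_0_iff)
    qed
  qed
  consider "q = r" | "s = t" | "u = p"
    using closed6[of p q r s t u] assms by blast
  then show ?thesis
  proof cases
    case 1
    then show ?thesis using step[of p q s t u] assms by (auto simp del: alt_sum.simps)
  next
    case 2
    then show ?thesis using step[of r s u p q] assms *(1) by (auto simp del: alt_sum.simps)
  next
    case 3
    then show ?thesis using step[of t u q r s] assms *(2) by (auto simp del: alt_sum.simps)
  qed
qed

text \<open>With p = - a + b and q = - b + c the three sums are p q^-1 p^-1, q p and q^-1 p^-1 q.
  Equating them gives q p p q = p and p q q p = q.\<close>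

lemma no_cyclic_words:
  assumes "distinct [a, b, c]" "set [a, b, c] \<subseteq> S"
    and "alt_sum [a, b, c, a] = alt_sum [b, c, a, b]" "alt_sum [b, c, a, b] = alt_sum [c, a, b, c]"
  shows False
proof -
  define p q where "p = - a + b" and "q = - b + c"
  have r: "- c + a = - q + - p" by (simp add: p_def q_def minus_add add.assoc)
  have "p + (- q + - p) = q + p" "q + p = (- q + - p) + q"
    using assms(3,4) r by (simp_all add: p_def q_def)
  note rel = this
  have "p = (p + (- q + - p)) + (p + q)"
    by (simp add: add.assoc diff_conv_add_uminus del: add_uminus_conv_diff)
  also have "\<dots> = q + p + p + q" by (simp only: rel(1) add.assoc)
  finally have 1: "q + p + p + q = p" ..
  have "p + q + q + p = p + q + (q + p)" by (simp only: add.assoc)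
  also have "\<dots> = p + q + ((- q + - p) + q)" by (simp only: rel(2))
  also have "\<dots> = q"
    by (simp add: add.assoc diff_conv_add_uminus del: add_uminus_conv_diff)
  finally have "p = 0"
    using mutual_conjugate_torsion[OF _ 1] torsion_free_int_mul[OF tf, of 6 p] by simp
  then show False using assms(1) by (simp add: p_def uminus_add_eq_0_iff)
qed

text \<open>This is \<open>K_{2,3}\<close> with \<open>p\<close>, \<open>q\<close> on one side and
  the \<open>v i\<close> on the other. All three words have the sum p - q, so any two form a closed
  walk. Coincidences of neighbouring letters are removed first; the tables then force a cyclic
  pattern.\<close>

lemma no_three_paths:
  fixes a b c d v :: "nat \<Rightarrow> 'g"
  assumes e: "\<And>i. i < 3 \<Longrightarrow> a i + p = b i + v i" "\<And>i. i < 3 \<Longrightarrow> c i + v i = d i + q"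
    and mem: "\<And>i. i < 3 \<Longrightarrow> {a i, b i, c i, d i} \<subseteq> S"
    and ne: "p \<noteq> q" "\<And>i. i < 3 \<Longrightarrow> v i \<noteq> p" "\<And>i. i < 3 \<Longrightarrow> v i \<noteq> q"
    and inj: "\<And>i j. i < 3 \<Longrightarrow> j < 3 \<Longrightarrow> v i = v j \<Longrightarrow> i = j"
  shows False
proof -
  have pq: "alt_sum [a i, b i, c i, d i] = p + - q" if "i < 3" for i
  proof -
    have "p = - a i + b i + v i" "v i = - c i + d i + q"
      using e[OF that] by (metis add.assoc minus_add_cancel)+
    then show ?thesis
      by (simp add: add.assoc diff_conv_add_uminus del: add_uminus_conv_diff)
  qed
  have rel: "alt_sum [a i, b i, c i, d i, d j, c j, b j, a j] = 0" if "i < 3" "j < 3" for i j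
    using pq[OF that(1)] alt_sum_rev[of "[a j, b j, c j, d j]"] pq[OF that(2)]
      alt_sum_append[of "[a i, b i, c i, d i]" "[d j, c j, b j, a j]"]
    by (simp del: alt_sum.simps add: add_diff_eq)
  have ab: "a i \<noteq> b i" and cd: "c i \<noteq> d i" if "i < 3" for i
    using e[OF that] ne(2,3)[OF that] by auto
  \<comment> \<open>If b i = c i, then \<open>p\<close> and \<open>q\<close> are joined directly by
    a i + p = d i + q. With another v j they form a triangle; its degeneracy fixes both middle
    labels as the third element of \<open>S\<close>, whence v i = v j.\<close>
  have bc: "b i \<noteq> c i" if i: "i < 3" for i
  proof
    assume deg: "b i = c i"
    have "a i + p = d i + q" using e[OF i] deg by simp
    then have ad: "a i \<noteq> d i" using ne(1) by auto
    obtain j where j: "j < 3" "j \<noteq> i" by (rule that[of "if i = 0 then 1 else 0"]) auto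
    have "alt_sum [a i, d i, d j, c j, b j, a j] = 0"
      using rel[OF i j(1)] deg by (simp add: add.assoc)
    then have *: "d i = d j" "c j = b j" "a j = a i"
      using triangle_degenerate[of "a i" "d i" "d j" "c j" "b j" "a j"] mem[OF i] mem[OF j(1)]
        ad ab[OF j(1)] cd[OF j(1)] by auto
    obtain x where "distinct [a i, d i, x]" "S = {a i, d i, x}"
      using third_element[of "a i" "d i"] ad mem[OF i] by auto
    then have "b i = b j"
      using mem[OF i] mem[OF j(1)] ab[OF i] ab[OF j(1)] cd[OF i] cd[OF j(1)] * deg by auto
    then have "v i = v j" using e(1)[OF i] e(1)[OF j(1)] * by (metis add_left_cancel)
    then show False using inj i j by blast
  qed
  have inj_b: "b i \<noteq> b j" if "i < 3" "j < 3" "i \<noteq> j" "a i = a j" for i j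
    using that e(1) inj by (metis add_left_cancel)
  have inj_c: "c i \<noteq> c j" if "i < 3" "j < 3" "i \<noteq> j" "d i = d j" for i j
    using that e(2) inj by (metis add_left_cancel)
  have rot: "alt_sum [d j, c j, b j, a j, a i, b i, c i, d i] = 0" if "i < 3" "j < 3" for i j
    using rel[OF that] alt_sum_rotate[of "a i" "b i" "[c i, d i, d j, c j, b j, a j]"]
      alt_sum_rotate[of "c i" "d i" "[d j, c j, b j, a j, a i, b i]"]
    by (simp del: alt_sum.simps)
  \<comment> \<open>Equal first letters cancel after rotation and leave a six-letter word. If the
    last letters agree as well, only b j, b i, c i, c j remain, and \<open>closed4\<close>
    applies.\<close>
  have inj_a: "a i \<noteq> a j" if ij: "i < 3" "j < 3" "i \<noteq> j" for i j
  proof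
    assume aa: "a i = a j"
    have 6: "alt_sum [d j, c j, b j, b i, c i, d i] = 0"
      using rot[OF ij(1,2)] aa by (simp add: add.assoc)
    have *: "b i \<noteq> b j" using inj_b[OF ij aa] .
    show False
    proof (cases "d i = d j")
      case True
      have "b i + - c i = b j + - c j"
        using pq[OF ij(1)] pq[OF ij(2)] aa True
        by (simp add: add.assoc diff_conv_add_uminus del: add_uminus_conv_diff)
          (metis add.assoc add_left_cancel add_right_cancel)
      then have "- b j + (b i + - c i) + c j = 0"
        by (simp only:) (simp add: add.assoc diff_conv_add_uminus del: add_uminus_conv_diff)
      then have "alt_sum [b j, b i, c i, c j] = 0"
        by (simp add: add.assoc diff_conv_add_uminus del: add_uminus_conv_diff)
      then show False
        using closed4[of "b j" "b i" "c i" "c j"] inj_c[OF ij True]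
          bc[OF ij(1)] bc[OF ij(2), symmetric] ij * mem[OF ij(1)] mem[OF ij(2)]
        by (auto simp del: alt_sum.simps)
    next
      case False
      then show False
        using closed6[of "d j" "c j" "b j" "b i" "c i" "d i"] 6 False
          bc[OF ij(1)] bc[OF ij(2), symmetric] cd[OF ij(1)] cd[OF ij(2), symmetric] ij *
          mem[OF ij(1)] mem[OF ij(2)] by (auto simp del: alt_sum.simps)
    qed
  qed
  have dist: "distinct [a 0, a 1, a 2]" using inj_a by simp
  have sub: "set [a 0, a 1, a 2] \<subseteq> S" using mem[of 0] mem[of 1] mem[of 2] by simp
  have S: "S = {a 0, a 1, a 2}" using S_eq[OF dist sub] .
  have w: "{b i, c i, d i} \<subseteq> S" "b i \<noteq> a i" "b i \<noteq> c i" "c i \<noteq> d i" if "i < 3" for i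
    using mem[OF that] ab[OF that] bc[OF that] cd[OF that] by auto
  have dd: "d i \<noteq> d j" if ij: "i < 3" "j < 3" "i \<noteq> j" for i j
  proof
    assume eq: "d i = d j"
    have "alt_sum [a i, b i, c i, c j, b j, a j] = 0"
      using rel[OF ij(1,2)] eq by (simp add: add.assoc)
    then show False
      using closed6[of "a i" "b i" "c i" "c j" "b j" "a j"] inj_a[OF ij] inj_c[OF ij eq]
        bc[OF ij(1)] bc[OF ij(2), symmetric]
        ab[OF ij(1)] ab[OF ij(2), symmetric] ij
        mem[OF ij(1)] mem[OF ij(2)] by (auto simp del: alt_sum.simps)
  qed
  \<comment> \<open>All cyclic neighbours now differ, and the distinct first letters of the two
    paths take the places of \<open>a\<close> and \<open>b\<close> in the table.\<close>
  have words: "([b i, c i, d i], [b j, c j, d j]) \<in> word_pairs x y z"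
    if "i < 3" "j < 3" "i \<noteq> j" "x = a i" "y = a j" "S = {x, y, z}" "distinct [x, y, z]"
    for i j x y z
    by (rule closed_walk8[OF that(6,7)])
      (use rel[OF that(1,2)] dd[OF that(1-3)] w[OF that(1)] w[OF that(2)] that(4-7)
        in \<open>auto simp del: alt_sum.simps\<close>)
  have S': "S = {a 0, a 2, a 1}" "S = {a 1, a 2, a 0}" using S by auto
  have dist': "distinct [a 0, a 2, a 1]" "distinct [a 1, a 2, a 0]" using dist by auto
  have cyc: "alt_sum [a 0, b 0, c 0, d 0] = alt_sum [a 1, b 1, c 1, d 1]"
    "alt_sum [a 1, b 1, c 1, d 1] = alt_sum [a 2, b 2, c 2, d 2]"
    using pq[of 0] pq[of 1] pq[of 2] by (simp_all del: alt_sum.simps)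
  have "([b 0, c 0, d 0], [b 1, c 1, d 1], [b 2, c 2, d 2]) \<in>
      {([a 1, a 2, a 0], [a 2, a 0, a 1], [a 0, a 1, a 2]),
       ([a 2, a 1, a 0], [a 0, a 2, a 1], [a 1, a 0, a 2])}"
    using word_pairs_compatible[OF dist words[OF _ _ _ refl refl S dist]
        words[OF _ _ _ refl refl S'(1) dist'(1)] words[OF _ _ _ refl refl S'(2) dist'(2)]]
    by simp
  then consider "b 0 = a 1" "c 0 = a 2" "d 0 = a 0" "b 1 = a 2" "c 1 = a 0" "d 1 = a 1"
      "b 2 = a 0" "c 2 = a 1" "d 2 = a 2"
    | "b 0 = a 2" "c 0 = a 1" "d 0 = a 0" "b 1 = a 0" "c 1 = a 2" "d 1 = a 1"
      "b 2 = a 1" "c 2 = a 0" "d 2 = a 2"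
    by auto
  then show False
  proof cases
    case 1
    show False by (rule no_cyclic_words[OF dist sub]) (use cyc 1 in simp_all)
  next
    case 2
    show False
      by (rule no_cyclic_words[OF dist'(1)]) (use cyc 2 sub in simp_all)
  qed
qed

end

text \<open>Both triangles are degenerate and use the same labels on the common edge. The remaining
  label is the third element of \<open>S\<close> in either triangle, so the two apexes
  coincide.\<close>

lemma (in no_unique_product) no_two_triangles:
  assumes e: "a1 + u = b1 + v" "a2 + v = b2 + w" "a1' + u = b1' + z" "a2' + z = b2' + w"
      "a3 + w = b3 + u"
    and mem: "{a1, b1, a2, b2, a1', b1', a2', b2', a3, b3} \<subseteq> S"
    and dist: "distinct [u, v, w, z]"
  shows False
proof -
  have ne: "a1 \<noteq> b1" "a2 \<noteq> b2" "a1' \<noteq> b1'" "a2' \<noteq> b2'" "a3 \<noteq> b3"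
    using e dist by auto
  have tri: "b1 = a2 \<and> b2 = a3 \<and> b3 = a1"
    if "a1 + u = b1 + v" "a2 + v = b2 + w" "{a1, b1, a2, b2} \<subseteq> S" "a1 \<noteq> b1" "a2 \<noteq> b2"
    for a1 b1 a2 b2 v
  proof -
    have "u = - a1 + b1 + v" "v = - a2 + b2 + w" "w = - a3 + b3 + u"
      using that e(5) by (metis add.assoc minus_add_cancel)+
    then have "alt_sum [a1, b1, a2, b2, a3, b3] + u = 0 + u"
      by (simp add: add.assoc)
    then have "alt_sum [a1, b1, a2, b2, a3, b3] = 0" by (simp only: add_right_cancel)
    then show ?thesis using triangle_degenerate[of a1 b1 a2 b2 a3 b3] that mem ne(5) by simp
  qed
  have 1: "b1 = a2 \<and> b2 = a3 \<and> b3 = a1" and 2: "b1' = a2' \<and> b2' = a3 \<and> b3 = a1'"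
    using tri[OF e(1,2)] tri[OF e(3,4)] mem ne by auto
  obtain x where "distinct [a3, b3, x]" "S = {a3, b3, x}"
    using third_element[of a3 b3] ne(5) mem by auto
  then have "b1 = b1'" using 1 2 mem ne by auto
  then have "v = z" using 1 2 e(1,3) by (metis add_left_cancel)
  then show False using dist by simp
qed

section \<open>From the group algebra to the support of \<alpha>\<close>

text \<open>Otherwise the coefficient of \<alpha>\<beta> at h + g would be a single product of two
  non-zero field elements.\<close>

lemma product_zero_other_pair:
  fixes \<alpha> \<beta> :: "'g::group_add \<Rightarrow>\<^sub>0 'f::field"
  assumes "\<alpha> * \<beta> = 0" "h \<in> Poly_Mapping.keys \<alpha>" "g \<in> Poly_Mapping.keys \<beta>"
  shows "\<exists>h' \<in> Poly_Mapping.keys \<alpha>. \<exists>g' \<in> Poly_Mapping.keys \<beta>. h' \<noteq> h \<and> h' + g' = h + g"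
proof (rule ccontr)
  assume none: "\<not> ?thesis"
  have inner: "(\<Sum>q. Poly_Mapping.lookup \<beta> q when h + g = l + q)
      = Poly_Mapping.lookup \<beta> (- l + (h + g))" for l
  proof -
    have "h + g = l + q \<longleftrightarrow> q = - l + (h + g)" for q
      by (metis add.assoc add_minus_cancel minus_add_cancel)
    then show ?thesis by (simp add: Sum_any_when_equal)
  qed
  have "0 = Poly_Mapping.lookup (\<alpha> * \<beta>) (h + g)" using assms(1) by simp
  also have "\<dots> = (\<Sum>l. Poly_Mapping.lookup \<alpha> l * Poly_Mapping.lookup \<beta> (- l + (h + g)))"
    by (simp add: lookup_mult inner)
  also have "\<dots> = (\<Sum>l. Poly_Mapping.lookup \<alpha> h * Poly_Mapping.lookup \<beta> g when l = h)"
  proof (rule Sum_any.cong)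
    fix l
    show "Poly_Mapping.lookup \<alpha> l * Poly_Mapping.lookup \<beta> (- l + (h + g))
        = (Poly_Mapping.lookup \<alpha> h * Poly_Mapping.lookup \<beta> g when l = h)"
    proof (cases "l = h")
      case False
      have "l + (- l + (h + g)) = h + g" by (rule add_minus_cancel)
      then have "l \<notin> Poly_Mapping.keys \<alpha> \<or> - l + (h + g) \<notin> Poly_Mapping.keys \<beta>"
        using none False by blast
      then show ?thesis using False by (auto simp: in_keys_iff)
    qed simp
  qed
  also have "\<dots> = Poly_Mapping.lookup \<alpha> h * Poly_Mapping.lookup \<beta> g" by simp
  finally show False using assms(2,3) by (simp add: in_keys_iff)
qed

text \<open>Starting anywhere in the support of \<open>\<beta>\<close> and always leaving the product with the fixed \<open>h\<close>,
  one walks through a finite set by steps of the form \<open>- h' + h\<close>, so the walk closes up.\<close>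

lemma no_unique_product_keys:
  fixes \<alpha> \<beta> :: "'g::group_add \<Rightarrow>\<^sub>0 'f::field"
  assumes "torsion_free TYPE('g)" "\<beta> \<noteq> 0" "card (Poly_Mapping.keys \<alpha>) = 3" "\<alpha> * \<beta> = 0"
  shows "no_unique_product (Poly_Mapping.keys \<alpha>)"
proof
  fix h assume h: "h \<in> Poly_Mapping.keys \<alpha>"
  let ?T = "(\<lambda>h'. - h' + h) ` (Poly_Mapping.keys \<alpha> - {h})"
  let ?B = "Poly_Mapping.keys \<beta>"
  \<comment> \<open>The walk is run contrapositively: if 0 is not a positive sum, \<open>r\<close>
    is a well-founded strict order on the support of \<beta>, and the second factorisation of h + g
    yields an element below a minimal \<open>g\<close>.\<close>
  define r where "r = {(g', g). g' \<in> ?B \<and> g \<in> ?B \<and> g' - g \<in> positive_sums ?T}"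
  show "0 \<in> positive_sums ?T"
  proof (rule ccontr)
    assume "0 \<notin> positive_sums ?T"
    then have "irrefl r" by (auto simp: irrefl_def r_def)
    moreover have "trans r"
    proof (rule transI)
      fix x y z assume "(x, y) \<in> r" "(y, z) \<in> r"
      then show "(x, z) \<in> r"
        using positive_sums_add[of "x - y" ?T "y - z"] by (auto simp: r_def add_diff_eq)
    qed
    ultimately have "acyclic r" by (simp add: acyclic_irrefl)
    moreover have "finite r"
      by (rule finite_subset[of _ "?B \<times> ?B"]) (auto simp: r_def)
    ultimately have "wf r" by (rule finite_acyclic_wf[rotated])
    moreover obtain g0 where "g0 \<in> ?B" using assms(2) by (metis keys_eq_empty ex_in_conv)
    ultimately obtain g where g: "g \<in> ?B" "\<And>g'. (g', g) \<in> r \<Longrightarrow> g' \<notin> ?B"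
      by (metis wfE_min)
    obtain h' g' where *: "h' \<in> Poly_Mapping.keys \<alpha>" "g' \<in> ?B" "h' \<noteq> h" "h' + g' = h + g"
      using product_zero_other_pair[OF assms(4) h g(1)] by blast
    then have "g' = - h' + h + g" by (metis add.assoc minus_add_cancel)
    then have "g' - g = - h' + h" by simp
    then have "(g', g) \<in> r"
      using * g(1) by (auto simp: r_def intro!: positive_sums.base)
    then show False using g(2) * by blast
  qed
qed (use assms in auto)

section \<open>From subgraphs to equations in the group\<close>

text \<open>The embedding \<open>f\<close> is the inverse of the vertex bijection; preimages under
  the edge bijection supply the edges.\<close>

lemma has_subgraph_iso_simple_graph:
  assumes "has_subgraph_iso X (simple_graph V E)"
  shows "\<exists>f. inj_on f V \<and> (\<forall>e\<in>E. \<exists>d\<in>medges X. mends X d = f ` e)"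
proof -
  obtain H \<phi> \<psi> where H: "msubgraph H X" and \<phi>: "bij_betw \<phi> (mverts H) V"
    and \<psi>: "bij_betw \<psi> (medges H) E" and ends: "\<And>d. d \<in> medges H \<Longrightarrow> \<psi> d = \<phi> ` mends H d"
    using assms by (auto simp: has_subgraph_iso_def misomorphic_def simple_graph_def)
  let ?f = "inv_into (mverts H) \<phi>"
  have "\<exists>d\<in>medges X. mends X d = ?f ` e" if "e \<in> E" for e
  proof -
    obtain d where d: "d \<in> medges H" "\<psi> d = e" using \<psi> \<open>e \<in> E\<close> by (auto simp: bij_betw_def)
    have "mends H d \<subseteq> mverts H"
      using H d(1) unfolding msubgraph_def loopless_multigraph_def by blast
    then have "?f ` e = mends H d"
      using ends[OF d(1)] d(2) \<phi> by (auto simp: bij_betw_def image_image subset_iff)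
    then show ?thesis using H d(1) by (auto simp: msubgraph_def)
  qed
  moreover have "inj_on ?f V" using \<phi> by (metis bij_betw_def inj_on_inv_into order_refl)
  ultimately show ?thesis by blast
qed

text \<open>An edge contains both orientations of its equation, so exchanging \<open>h\<close> and
  \<open>h'\<close> allows either endpoint to come first.\<close>

lemma zero_divisor_graph_adjacent:
  assumes "d \<in> medges (zero_divisor_graph \<alpha> \<beta>)" "mends (zero_divisor_graph \<alpha> \<beta>) d = {x, y}"
  shows "\<exists>h \<in> Poly_Mapping.keys \<alpha>. \<exists>h' \<in> Poly_Mapping.keys \<alpha>. h + x = h' + y"
proof -
  obtain h h' g g' where "h \<in> Poly_Mapping.keys \<alpha>" "h' \<in> Poly_Mapping.keys \<alpha>" "h + g = h' + g'"
    "d = {(h, h', g, g'), (h', h, g', g)}"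
    using assms(1) by (auto simp: zero_divisor_graph_def)
  moreover from this assms(2) have "{g, g'} = {x, y}"
    by (simp add: zero_divisor_graph_def)
  ultimately show ?thesis by (metis doubleton_eq_iff)
qed

theorem theorem1p3:
  fixes \<alpha> \<beta> :: "'g::group_add \<Rightarrow>\<^sub>0 'f::field"
  assumes "torsion_free TYPE('g)"
    and "\<alpha> \<noteq> 0" and "\<beta> \<noteq> 0"
    and "card (Poly_Mapping.keys \<alpha>) = 3"
    and "\<alpha> * \<beta> = 0"
  shows "\<not> has_subgraph_iso (zero_divisor_graph \<alpha> \<beta>) two_triangles \<and>
         \<not> has_subgraph_iso (zero_divisor_graph \<alpha> \<beta>) (complete_bipartite 2 3)"
proof -
  interpret no_unique_product "Poly_Mapping.keys \<alpha>"
    using no_unique_product_keys assms by blast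
  have adj: "\<exists>h \<in> Poly_Mapping.keys \<alpha>. \<exists>h' \<in> Poly_Mapping.keys \<alpha>. h + f x = h' + f y"
    if "\<forall>e\<in>E. \<exists>d\<in>medges (zero_divisor_graph \<alpha> \<beta>). mends (zero_divisor_graph \<alpha> \<beta>) d = f ` e"
      and "{x, y} \<in> E" for E x y and f :: "'v \<Rightarrow> 'g"
    using bspec[OF that] zero_divisor_graph_adjacent by fastforce
  have "\<not> has_subgraph_iso (zero_divisor_graph \<alpha> \<beta>) two_triangles"
  proof
    assume "has_subgraph_iso (zero_divisor_graph \<alpha> \<beta>) two_triangles"
    then obtain f where inj: "inj_on f {0, 1, 2, 3 :: nat}" and
      E: "\<forall>e\<in>{{0, 1}, {1, 2}, {2, 0}, {0, 3}, {3, 2}}.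
        \<exists>d\<in>medges (zero_divisor_graph \<alpha> \<beta>). mends (zero_divisor_graph \<alpha> \<beta>) d = f ` e"
      using has_subgraph_iso_simple_graph unfolding two_triangles_def by metis
    have "distinct [f 0, f 1, f 2, f 3]" using inj by (simp add: inj_on_def)
    then show False
      using adj[OF E, of 0 1] adj[OF E, of 1 2] adj[OF E, of 2 0] adj[OF E, of 0 3]
        adj[OF E, of 3 2]
        no_two_triangles[where u = "f 0" and v = "f 1" and w = "f 2" and z = "f 3"]
      by simp blast
  qed
  moreover have "\<not> has_subgraph_iso (zero_divisor_graph \<alpha> \<beta>) (complete_bipartite 2 3)"
  proof
    assume "has_subgraph_iso (zero_divisor_graph \<alpha> \<beta>) (complete_bipartite 2 3)"
    from has_subgraph_iso_simple_graph[OF this[unfolded complete_bipartite_def]]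
    obtain f where inj: "inj_on f (Inl ` {..<2} \<union> Inr ` {..<3} :: (nat + nat) set)" and
      E: "\<forall>e\<in>{{Inl i, Inr j} | i j. i < 2 \<and> j < 3}.
        \<exists>d\<in>medges (zero_divisor_graph \<alpha> \<beta>). mends (zero_divisor_graph \<alpha> \<beta>) d = f ` e"
      by blast
    \<comment> \<open>The edge labels are chosen as functions of \<open>j\<close>, the form in which
      \<open>no_three_paths\<close> takes them.\<close>
    have edges: "\<exists>a b. \<forall>j. j < 3 \<longrightarrow> a j \<in> Poly_Mapping.keys \<alpha> \<and> b j \<in> Poly_Mapping.keys \<alpha> \<and>
        a j + f (Inl i) = b j + f (Inr j)" if "i < 2" for i
    proof -
      have "\<forall>j. \<exists>h h'. j < 3 \<longrightarrow> h \<in> Poly_Mapping.keys \<alpha> \<and> h' \<in> Poly_Mapping.keys \<alpha> \<and>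
          h + f (Inl i) = h' + f (Inr j)"
        using adj[OF E, of "Inl i"] that by blast
      then show ?thesis unfolding choice_iff .
    qed
    obtain a b where ab: "\<forall>j. j < 3 \<longrightarrow> a j \<in> Poly_Mapping.keys \<alpha> \<and>
        b j \<in> Poly_Mapping.keys \<alpha> \<and> a j + f (Inl 0) = b j + f (Inr j)"
      using edges[of 0] by auto
    \<comment> \<open>The order \<open>d\<close>, \<open>c\<close> is deliberate: this edge is read
      from the second end of the path back to the middle vertex.\<close>
    obtain d c where dc: "\<forall>j. j < 3 \<longrightarrow> d j \<in> Poly_Mapping.keys \<alpha> \<and>
        c j \<in> Poly_Mapping.keys \<alpha> \<and> d j + f (Inl 1) = c j + f (Inr j)"
      using edges[of 1] by auto
    have ne: "f x \<noteq> f y" if "x \<noteq> y" "x \<in> Inl ` {..<2} \<union> Inr ` {..<3}"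
      "y \<in> Inl ` {..<2} \<union> Inr ` {..<3}" for x y
      using inj that by (meson inj_onD)
    show False
    proof (rule no_three_paths[of a "f (Inl 0)" b "\<lambda>j. f (Inr j)" c d "f (Inl 1)"])
      show "i = j" if "i < 3" "j < 3" "f (Inr i) = f (Inr j)" for i j
        using ne[of "Inr i" "Inr j"] that by auto
    qed (use ab dc ne in auto)
  qed
  ultimately show ?thesis ..
qed

end
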